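(* Let $(S,\cdot)$ be an adequate partial semigroup, let $\mathcal{K}$ be a filter on $S$ such that $\overline{\mathcal{K}}$ is a compact subsemigroup of $\delta S$, and let $A\subseteq S$. Then $A$ is a member of an idempotent in $\overline{\mathcal{K}}$ if and only if there exist a dynamical system $(X,\langle T_s\rangle_{s\in S})$, points $x,y\in X$, and a neighborhood $U$ of $y$ such that: (1) the pair $(x,y)$ is jointly $\mathcal{K}$-recurrent, and (2) $A=\{s\in S: T_s(x)\in U\}$.
   Context: A partial semigroup is a pair $(S,\cdot)$ where $\cdot$ maps a subset of $S\times S$ to $S$ and for all $a,b,c\in S$, $(a\cdot b)\cdot c=a\cdot(b\cdot c)$ in the sense that if either side is defined, then so is the other and they are equal. For $s\in S$, $\phi(s)=\{t\in S: s\cdot t \text{ is defined}\}$; for a nonempty finite $H\subseteq S$, $\sigma(H)=\bigcap_{s\in H}\phi(s)$. $S$ is adequate if $\sigma(H)\neq\emptyset$ for every nonempty finite $H\subseteq S$. $\beta S$ is the Stone-Čech compactification of the discrete space $S$ (the set of ultrafilters on $S$ with basic clopen sets $\overline{A}=\{p\in\beta S: A\in p\}$). $\delta S=\bigcap_{x\in S}cl_{\beta S}(\phi(x))$. For $x\in S$, $A\subseteq S$: $x^{-1}A=\{y\in\phi(x): x\cdot y\in A\}$. For $p\in\beta S$, $q\in\delta S$, $p\cdot q$ is the ultrafilter with $A\in p\cdot q\iff\{x\in S: x^{-1}A\in q\}\in p$. With this operation $\delta S$ is a compact Hausdorff right topological semigroup. For a filter $\mathcal{K}$ on $S$: $\overline{\mathcal{K}}=\{p\in\beta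 S:\mathcal{K}\subseteq p\}$ and $\mathcal{L}(\mathcal{K})=\{A\subseteq S: S\setminus A\notin\mathcal{K}\}$. A dynamical system (for the adequate partial semigroup $S$) is a pair $(X,\langle T_s\rangle_{s\in S})$ such that $X$ is a compact Hausdorff space, each $T_s:X\to X$ is continuous, and for all $s,t\in S$, $T_s\circ T_t=T_{st}$ whenever $t\in\phi(s)$. The pair $(x,y)$ of points of $X$ is jointly $\mathcal{K}$-recurrent if and only if for every neighborhood $U$ of $y$, $\{s\in S: T_s(x)\in U\text{ and }T_s(y)\in U\}\in\mathcal{L}(\mathcal{K})$. *)

theory Defs
  imports "HOL-Analysis.Analysis"
begin

text \<open>
  The underlying set of a partial semigroup is the type \<open>'a\<close>; \<open>m a b = None\<close> means that
  \<open>a \<cdot> b\<close> is undefined.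
\<close>

text \<open>Both sides of the equation are \<open>None\<close> exactly when the respective triple product is undefined.\<close>

definition partial_semigroup :: "('a \<Rightarrow> 'a \<Rightarrow> 'a option) \<Rightarrow> bool" where
  "partial_semigroup m \<longleftrightarrow>
     (\<forall>a b c. Option.bind (m a b) (\<lambda>d. m d c) = Option.bind (m b c) (\<lambda>d. m a d))"

definition phi :: "('a \<Rightarrow> 'a \<Rightarrow> 'a option) \<Rightarrow> 'a \<Rightarrow> 'a set" where
  "phi m s = {t. m s t \<noteq> None}"

definition sigma :: "('a \<Rightarrow> 'a \<Rightarrow> 'a option) \<Rightarrow> 'a set \<Rightarrow> 'a set" where
  "sigma m H = (\<Inter>s\<in>H. phi m s)"

definition adequate_partial_semigroup :: "('a \<Rightarrow> 'a \<Rightarrow> 'a option) \<Rightarrow> bool" where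
  "adequate_partial_semigroup m \<longleftrightarrow>
     partial_semigroup m \<and> (\<forall>H. finite H \<and> H \<noteq> {} \<longrightarrow> sigma m H \<noteq> {})"

definition left_quotient :: "('a \<Rightarrow> 'a \<Rightarrow> 'a option) \<Rightarrow> 'a \<Rightarrow> 'a set \<Rightarrow> 'a set" where
  "left_quotient m x A = {y \<in> phi m x. the (m x y) \<in> A}"

text \<open>
  The library type \<open>'a filter\<close> contains the improper filter \<open>bot\<close>, and its order is reverse
  inclusion of the families of member sets.
\<close>

definition members :: "'a filter \<Rightarrow> 'a set set" where
  "members F = {A. eventually (\<lambda>s. s \<in> A) F}"

definition is_ultrafilter :: "'a filter \<Rightarrow> bool" where
  "is_ultrafilter p \<longleftrightarrow> p \<noteq> bot \<and> (\<forall>A. A \<in> members p \<or> - A \<in> members p)"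

definition beta_basic :: "'a set \<Rightarrow> 'a filter set" where
  "beta_basic A = {p. is_ultrafilter p \<and> A \<in> members p}"

definition beta :: "'a filter topology" where
  "beta = topology_generated_by (range beta_basic)"

text \<open>A point \<open>t\<close> of the discrete space is identified with the principal ultrafilter at \<open>t\<close>.\<close>

definition delta :: "('a \<Rightarrow> 'a \<Rightarrow> 'a option) \<Rightarrow> 'a filter set" where
  "delta m = (\<Inter>x. beta closure_of ((\<lambda>t. principal {t}) ` phi m x))"

text \<open>
  For \<open>p\<close> in \<open>beta\<close> and \<open>q\<close> in \<open>delta m\<close> the argument of \<open>Abs_filter\<close> is a filter, see
  \<open>members_beta_mult\<close> below; outside this domain the value is irrelevant.
\<close>

definition beta_mult :: "('a \<Rightarrow> 'a \<Rightarrow> 'a option) \<Rightarrow> 'a filter \<Rightarrow> 'a filter \<Rightarrow> 'a filter" where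
  "beta_mult m p q = Abs_filter (\<lambda>P. {x. left_quotient m x {s. P s} \<in> members q} \<in> members p)"

lemma topspace_beta: "topspace beta = {p. is_ultrafilter p}"
proof -
  have "p \<in> beta_basic UNIV" if "is_ultrafilter p" for p :: "'b filter"
    using that by (simp add: beta_basic_def members_def)
  then show ?thesis
    by (auto simp: beta_def) (auto simp: beta_basic_def)
qed

lemma phi_in_members_delta:
  assumes "q \<in> delta m"
  shows "phi m x \<in> members q"
proof (rule ccontr)
  assume *: "phi m x \<notin> members q"
  have q: "q \<in> beta closure_of ((\<lambda>t. principal {t}) ` phi m x)"
    using assms by (auto simp: delta_def)
  then have "is_ultrafilter q"
    using closure_of_subset_topspace[of beta] topspace_beta by blast
  with * have "q \<in> beta_basic (- phi m x)"
    by (auto simp: is_ultrafilter_def beta_basic_def)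
  moreover have "openin beta (beta_basic (- phi m x))"
    by (auto simp: beta_def intro: topology_generated_by_Basis)
  ultimately obtain t where "t \<in> phi m x" "principal {t} \<in> beta_basic (- phi m x)"
    using q unfolding in_closure_of by blast
  then show False
    by (auto simp: beta_basic_def members_def eventually_principal)
qed

lemma members_beta_mult:
  assumes "q \<in> delta m"
  shows "A \<in> members (beta_mult m p q) \<longleftrightarrow> {x. left_quotient m x A \<in> members q} \<in> members p"
proof -
  let ?F = "\<lambda>P. {x. left_quotient m x {s. P s} \<in> members q} \<in> members p"
  have lq: "left_quotient m x {s. P s} \<in> members q \<longleftrightarrow>
      eventually (\<lambda>y. y \<in> phi m x \<and> P (the (m x y))) q" for x P
    by (simp add: left_quotient_def members_def)
  have "is_filter ?F"
  proof
    show "?F (\<lambda>_. True)"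
      using phi_in_members_delta[OF assms]
      by (simp add: left_quotient_def members_def)
  next
    fix P Q assume "?F P" "?F Q"
    then show "?F (\<lambda>x. P x \<and> Q x)"
      unfolding lq by (simp add: members_def) (auto elim: eventually_elim2 simp: conj_ac eventually_conj_iff)
  next
    fix P Q assume "\<forall>x. P x \<longrightarrow> Q x" "?F P"
    then show "?F Q"
      unfolding lq by (simp add: members_def) (erule eventually_mono, erule eventually_mono, blast)
  qed
  then show ?thesis
    by (simp add: beta_mult_def members_def eventually_Abs_filter)
qed

definition filter_hull :: "'a filter \<Rightarrow> 'a filter set" where
  "filter_hull K = {p. is_ultrafilter p \<and> members K \<subseteq> members p}"

definition compact_subsemigroup_delta ::
    "('a \<Rightarrow> 'a \<Rightarrow> 'a option) \<Rightarrow> 'a filter set \<Rightarrow> bool" where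
  "compact_subsemigroup_delta m C \<longleftrightarrow>
     C \<subseteq> delta m \<and> compactin beta C \<and> (\<forall>p\<in>C. \<forall>q\<in>C. beta_mult m p q \<in> C)"

definition script_L :: "'a filter \<Rightarrow> 'a set set" where
  "script_L K = {A. - A \<notin> members K}"

text \<open>
  Phase spaces are abstract topologies, so that the point set \<open>topspace X\<close> may be any subset
  of the type of points; \<open>T s\<close> is only constrained on \<open>topspace X\<close>.
\<close>

definition dynamical_system ::
    "('a \<Rightarrow> 'a \<Rightarrow> 'a option) \<Rightarrow> 'x topology \<Rightarrow> ('a \<Rightarrow> 'x \<Rightarrow> 'x) \<Rightarrow> bool" where
  "dynamical_system m X T \<longleftrightarrow>
     compact_space X \<and> Hausdorff_space X \<and> (\<forall>s. continuous_map X X (T s)) \<and>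
     (\<forall>s t. t \<in> phi m s \<longrightarrow> (\<forall>x\<in>topspace X. T s (T t x) = T (the (m s t)) x))"

definition neighborhood :: "'x topology \<Rightarrow> 'x \<Rightarrow> 'x set \<Rightarrow> bool" where
  "neighborhood X y U \<longleftrightarrow> U \<subseteq> topspace X \<and> (\<exists>V. openin X V \<and> y \<in> V \<and> V \<subseteq> U)"

definition jointly_recurrent ::
    "'a filter \<Rightarrow> 'x topology \<Rightarrow> ('a \<Rightarrow> 'x \<Rightarrow> 'x) \<Rightarrow> 'x \<Rightarrow> 'x \<Rightarrow> bool" where
  "jointly_recurrent K X T x y \<longleftrightarrow>
     (\<forall>U. neighborhood X y U \<longrightarrow> {s. T s x \<in> U \<and> T s y \<in> U} \<in> script_L K)"

text \<open>
  HOL cannot quantify existentially over types, so the existence of a dynamical system whose phase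
  space lies in \<open>'x\<close> is a predicate with the type of points as a parameter.
  The type \<open>'a option \<Rightarrow> bool\<close>, i.e. \<open>{0,1}\<close> to the power of \<open>S\<close> with one additional point, is
  large enough for the systems one has to construct; that a representation yields an idempotent
  has to be stated for an arbitrary type \<open>'x\<close>, so that it covers systems of any size.
\<close>

definition dynamically_represented ::
    "'x itself \<Rightarrow> ('a \<Rightarrow> 'a \<Rightarrow> 'a option) \<Rightarrow> 'a filter \<Rightarrow> 'a set \<Rightarrow> bool" where
  "dynamically_represented _ m K A \<longleftrightarrow>
     (\<exists>(X :: 'x topology) T x y U.
        dynamical_system m X T \<and> x \<in> topspace X \<and> y \<in> topspace X \<and> neighborhood X y U \<and>
        jointly_recurrent K X T x y \<and> A = {s. T s x \<in> U})"

end

theory Submission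
  imports Defs
begin

text \<open>
  A closed subset of \<open>beta\<close> is the hull of a filter, so the Ellis--Numakura argument can be run on
  filters: among the filters finer than a given one whose hull is closed under multiplication,
  take a maximally fine proper one \<open>G\<close> and \<open>p\<close> in its hull. Both \<open>G \<cdot> p\<close> and the filter whose
  hull is the stabilizer \<open>{q. q \<cdot> p = p}\<close> must then be \<open>G\<close> itself, so \<open>p \<cdot> p = p\<close>.

  A representation of \<open>A\<close> makes the ultrafilters \<open>p\<close> in the hull of \<open>K\<close> along which both
  \<open>T s x\<close> and \<open>T s y\<close> converge to \<open>y\<close> such a subsemigroup. Conversely, an idempotent \<open>p\<close>
  containing \<open>A\<close> gives the shift system on \<open>{0,1}\<close> to the power of \<open>S\<close> with an adjoined identity,
  \<open>x\<close> being the characteristic function of \<open>A\<close> and \<open>y\<close> the limit of \<open>T s x\<close> along \<open>p\<close>.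
\<close>

section \<open>Filters, ultrafilters and hulls\<close>

lemma filter_hull_iff: "p \<in> filter_hull F \<longleftrightarrow> is_ultrafilter p \<and> p \<le> F"
proof -
  have "p \<le> F" if "members F \<subseteq> members p"
    unfolding le_filter_def
  proof (intro allI impI)
    fix P assume "eventually P F"
    then have "{x. P x} \<in> members F"
      by (simp add: members_def)
    with that have "{x. P x} \<in> members p"
      by blast
    then show "eventually P p"
      by (simp add: members_def)
  qed
  then show ?thesis
    by (auto simp: filter_hull_def members_def le_filter_def)
qed

lemma ultrafilter_eventually_not:
  assumes "is_ultrafilter p"
  shows "eventually (\<lambda>x. \<not> P x) p \<longleftrightarrow> \<not> eventually P p"
proof
  assume "eventually (\<lambda>x. \<not> P x) p"
  moreover have "p \<noteq> bot"
    using assms by (simp add: is_ultrafilter_def)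
  ultimately show "\<not> eventually P p"
    using eventually_conj[of P p "\<lambda>x. \<not> P x"] by (auto simp: trivial_limit_def)
next
  assume "\<not> eventually P p"
  moreover have "{x. P x} \<in> members p \<or> - {x. P x} \<in> members p"
    using assms unfolding is_ultrafilter_def by blast
  ultimately show "eventually (\<lambda>x. \<not> P x) p"
    by (simp add: members_def)
qed

text \<open>A set in \<open>p\<close> but not in \<open>q\<close> would have its complement in
  \<open>q\<close>, hence also in \<open>p\<close>.\<close>

lemma ultrafilter_le_eq:
  assumes "is_ultrafilter p" "is_ultrafilter q" "p \<le> q"
  shows "p = q"
proof (rule antisym[OF assms(3)])
  show "q \<le> p"
    unfolding le_filter_def
    using assms ultrafilter_eventually_not le_filter_def by metis
qed

text \<open>Zorn's lemma for the order reversing inclusion of member sets. The infimum of a nonempty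
  chain has as members just those of the filters in the chain, so it stays proper; closure of
  \<open>P\<close> under infima keeps it in the family.\<close>

lemma minimal_filter_exists:
  fixes F :: "'a filter"
  assumes "F \<noteq> bot" "P F"
    and Inf: "\<And>C. C \<noteq> {} \<Longrightarrow> \<forall>G\<in>C. P G \<Longrightarrow> P (Inf C)"
  obtains G where "G \<le> F" "G \<noteq> bot" "P G"
    "\<And>H. H \<le> G \<Longrightarrow> H \<noteq> bot \<Longrightarrow> P H \<Longrightarrow> H = G"
proof -
  define \<A> where "\<A> = {G. G \<le> F \<and> G \<noteq> bot \<and> P G}"
  have "\<exists>G\<in>\<A>. \<forall>H\<in>\<A>. G \<ge> H \<longrightarrow> H = G"
  proof (rule predicate_Zorn)
    show "partial_order_on \<A> (relation_of (\<ge>) \<A>)"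
      by (rule partial_order_on_relation_ofI) auto
  next
    fix C assume C: "C \<in> Chains (relation_of (\<ge>) \<A>)"
    show "\<exists>u\<in>\<A>. \<forall>a\<in>C. a \<ge> u"
    proof (cases "C = {}")
      case True
      then show ?thesis
        using assms(1,2) by (auto simp: \<A>_def)
    next
      case False
      have sub: "C \<subseteq> \<A>"
        using Chains_relation_of[OF C] .
      have total: "G \<le> H \<or> H \<le> G" if "G \<in> C" "H \<in> C" for G H
        using C that by (auto simp: Chains_def relation_of_def)
      have "eventually Q (Inf C) \<longleftrightarrow> (\<exists>G\<in>C. eventually Q G)" for Q
        by (rule eventually_Inf_base[OF False]) (use total in force)
      then have "Inf C \<noteq> bot"
        using sub by (auto simp: trivial_limit_def \<A>_def)
      moreover have "Inf C \<le> F"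
        using False sub by (auto simp: \<A>_def intro: Inf_lower2)
      moreover have "P (Inf C)"
        using False sub by (intro Inf) (auto simp: \<A>_def)
      ultimately show ?thesis
        by (auto simp: \<A>_def intro!: bexI[of _ "Inf C"] Inf_lower)
    qed
  qed
  then obtain G where G: "G \<in> \<A>" "\<And>H. H \<in> \<A> \<Longrightarrow> H \<le> G \<Longrightarrow> H = G"
    by blast
  show thesis
  proof (rule that)
    show "H = G" if "H \<le> G" "H \<noteq> bot" "P H" for H
      using G that by (auto simp: \<A>_def)
  qed (use G(1) in \<open>auto simp: \<A>_def\<close>)
qed

lemma ultrafilter_exists:
  assumes "F \<noteq> bot"
  obtains p where "p \<in> filter_hull F"
proof -
  obtain G where G: "G \<le> F" "G \<noteq> bot" "\<And>H. H \<le> G \<Longrightarrow> H \<noteq> bot \<Longrightarrow> H = G"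
    using minimal_filter_exists[of F "\<lambda>_. True"] assms by metis
  \<comment> \<open>Adding \<open>A\<close> to the minimal filter \<open>G\<close> either gives the
    improper filter, so that the complement of \<open>A\<close> is already a member, or changes
    nothing, so that \<open>A\<close> is one.\<close>
  have "A \<in> members G \<or> - A \<in> members G" for A
  proof (cases "inf G (principal A) = bot")
    case True
    then have "eventually (\<lambda>x. x \<notin> A) G"
      by (simp add: trivial_limit_def eventually_inf_principal)
    then show ?thesis
      by (simp add: members_def)
  next
    case False
    then have "inf G (principal A) = G"
      by (intro G) auto
    moreover have "eventually (\<lambda>x. x \<in> A) (inf G (principal A))"
      by (simp add: eventually_inf_principal)
    ultimately have "eventually (\<lambda>x. x \<in> A) G"
      by simp
    then show ?thesis
      by (simp add: members_def)
  qed
  with G show thesis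
    by (intro that[of G]) (simp add: filter_hull_iff is_ultrafilter_def)
qed

section \<open>The product of ultrafilters as a nested quantifier\<close>

lemma eventually_beta_mult:
  assumes "q \<in> delta m"
  shows "eventually P (beta_mult m p q) \<longleftrightarrow>
    (\<forall>\<^sub>F x in p. \<forall>\<^sub>F y in q. \<exists>z. m x y = Some z \<and> P z)"
proof -
  have "left_quotient m x {s. P s} = {y. \<exists>z. m x y = Some z \<and> P z}" for x
    by (auto simp: left_quotient_def phi_def)
  then show ?thesis
    using members_beta_mult[OF assms, of "{s. P s}" p] by (simp add: members_def)
qed

lemma delta_eventually_defined:
  assumes "q \<in> delta m"
  shows "\<forall>\<^sub>F y in q. \<exists>z. m x y = Some z"
  using phi_in_members_delta[OF assms, of x] by (simp add: members_def phi_def)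

text \<open>Associativity in the shape in which it occurs under nested quantifiers: each side says
  that its triple product is defined and satisfies \<open>P\<close>.\<close>

lemma partial_semigroup_bind:
  assumes "partial_semigroup m"
  shows "(\<exists>d. m b c = Some d \<and> (\<exists>z. m a d = Some z \<and> P z)) \<longleftrightarrow>
    (\<exists>w. m a b = Some w \<and> (\<exists>z. m w c = Some z \<and> P z))"
proof -
  have "Option.bind (m a b) (\<lambda>d. m d c) = Option.bind (m b c) (\<lambda>d. m a d)"
    using assms by (simp add: partial_semigroup_def)
  then show ?thesis
    by (cases "m a b"; cases "m b c") auto
qed

lemma beta_mult_assoc:
  assumes m: "partial_semigroup m"
    and q: "q \<in> delta m" and r: "r \<in> delta m" "r \<noteq> bot" and qr: "beta_mult m q r \<in> delta m"
  shows "beta_mult m (beta_mult m p q) r = beta_mult m p (beta_mult m q r)"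
proof (rule filter_eq_iff[THEN iffD2], rule allI)
  fix P
  \<comment> \<open>The factor \<open>m a b\<close> is independent of \<open>c\<close> and moves
    across the quantifier over \<open>c\<close>. If it is undefined, the right-hand side is false
    because \<open>r\<close> is proper.\<close>
  have "(\<exists>w. m a b = Some w \<and> (\<forall>\<^sub>F c in r. \<exists>z. m w c = Some z \<and> P z)) \<longleftrightarrow>
    (\<forall>\<^sub>F c in r. \<exists>w. m a b = Some w \<and> (\<exists>z. m w c = Some z \<and> P z))" for a b
    using r(2) by (cases "m a b") (auto simp: trivial_limit_def)
  then show "eventually P (beta_mult m (beta_mult m p q) r) \<longleftrightarrow>
      eventually P (beta_mult m p (beta_mult m q r))"
    by (simp add: eventually_beta_mult q r qr partial_semigroup_bind[OF m])
qed

section \<open>Right translations and idempotents in closed subsemigroups\<close>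

lemma beta_mult_mono: "q \<in> delta m \<Longrightarrow> p \<le> p' \<Longrightarrow> beta_mult m p q \<le> beta_mult m p' q"
  by (simp add: le_filter_def eventually_beta_mult)

text \<open>Right translation by \<open>p\<close> is continuous, so it maps a closed set onto a
  closed set. The filter form of this: adding to \<open>F\<close> the preimages of all members of
  \<open>r\<close> leaves a proper filter, and any ultrafilter \<open>q\<close> below it is a
  preimage of \<open>r\<close>.\<close>

lemma ultrafilter_below_beta_mult:
  assumes p: "p \<in> delta m" "is_ultrafilter p"
    and r: "is_ultrafilter r" "r \<le> beta_mult m F p"
  obtains q where "q \<in> filter_hull F" "beta_mult m q p \<le> r"
proof -
  \<comment> \<open>\<open>D P\<close> consists of the \<open>x\<close> whose left quotient of
    \<open>P\<close> belongs to \<open>p\<close>. These sets are closed under intersection, so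
    \<open>\<B>\<close> is a filter base and properness can be checked on each of its
    elements.\<close>
  define D where "D P = {x. \<forall>\<^sub>F y in p. \<exists>z. m x y = Some z \<and> P z}" for P
  define \<B> where "\<B> = {inf F (principal (D P)) |P. eventually P r}"
  have D: "D P \<inter> D Q = D (\<lambda>z. P z \<and> Q z)" for P Q
    by (auto simp: D_def simp flip: eventually_conj_iff intro!: always_eventually elim!: eventually_rev_mp)
  have Inf: "eventually Q (Inf \<B>) \<longleftrightarrow> (\<exists>G\<in>\<B>. eventually Q G)" for Q
  proof (rule eventually_Inf_base)
    show "\<B> \<noteq> {}"
      by (auto simp: \<B>_def intro!: exI[of _ "\<lambda>_. True"])
    fix G H assume "G \<in> \<B>" "H \<in> \<B>"
    then obtain P Q where PQ: "eventually P r" "G = inf F (principal (D P))"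
      "eventually Q r" "H = inf F (principal (D Q))"
      by (auto simp: \<B>_def)
    have "inf G H = inf F (principal (D P \<inter> D Q))"
      unfolding PQ inf_principal[symmetric] by (simp add: ac_simps)
    moreover have "eventually (\<lambda>z. P z \<and> Q z) r"
      using PQ by (simp add: eventually_conj_iff)
    ultimately show "\<exists>x\<in>\<B>. x \<le> inf G H"
      unfolding D by (auto simp: \<B>_def)
  qed
  have "inf F (principal (D P)) \<noteq> bot" if P: "eventually P r" for P
  proof
    assume "inf F (principal (D P)) = bot"
    then have "\<forall>\<^sub>F x in F. \<forall>\<^sub>F y in p. \<not> (\<exists>z. m x y = Some z \<and> P z)"
      by (simp add: trivial_limit_def eventually_inf_principal D_def
          ultrafilter_eventually_not[OF p(2)] del: not_ex)
    \<comment> \<open>The negated statement also allows undefined products;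
      \<open>p \<in> delta m\<close> rules these out for \<open>p\<close>-most \<open>y\<close>,
      which puts the complement of \<open>P\<close> into \<open>F \<cdot> p\<close>.\<close>
    then have "\<forall>\<^sub>F x in F. \<forall>\<^sub>F y in p. \<exists>z. m x y = Some z \<and> \<not> P z"
    proof (rule eventually_mono)
      fix x assume "\<forall>\<^sub>F y in p. \<not> (\<exists>z. m x y = Some z \<and> P z)"
      with delta_eventually_defined[OF p(1), of x]
      show "\<forall>\<^sub>F y in p. \<exists>z. m x y = Some z \<and> \<not> P z"
        by eventually_elim auto
    qed
    then have "eventually (\<lambda>z. \<not> P z) r"
      using r(2) by (simp add: le_filter_def eventually_beta_mult[OF p(1)])
    with P show False
      by (simp add: ultrafilter_eventually_not[OF r(1)])
  qed
  then have "Inf \<B> \<noteq> bot"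
    unfolding trivial_limit_def Inf by (auto simp: \<B>_def)
  then obtain q where "q \<in> filter_hull (Inf \<B>)"
    by (rule ultrafilter_exists)
  then have q: "is_ultrafilter q" "q \<le> Inf \<B>"
    by (auto simp: filter_hull_iff)
  have le: "q \<le> inf F (principal (D P))" if "eventually P r" for P
    by (rule order_trans[OF q(2)], rule Inf_lower) (use that in \<open>auto simp: \<B>_def\<close>)
  show thesis
  proof (rule that)
    show "q \<in> filter_hull F"
      using le[of "\<lambda>_. True"] q(1) by (simp add: filter_hull_iff)
    show "beta_mult m q p \<le> r"
      using le by (auto simp: le_filter_def eventually_beta_mult[OF p(1)]
          eventually_inf_principal D_def)
  qed
qed

theorem idempotent_in_filter_hull:
  assumes m: "partial_semigroup m"
    and "F \<noteq> bot"
    and delta: "filter_hull F \<subseteq> delta m"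
    and mult: "\<And>p q. p \<in> filter_hull F \<Longrightarrow> q \<in> filter_hull F \<Longrightarrow> beta_mult m p q \<in> filter_hull F"
  shows "\<exists>p\<in>filter_hull F. beta_mult m p p = p"
proof -
  define P where "P G \<longleftrightarrow> (\<forall>p\<in>filter_hull G. \<forall>q\<in>filter_hull G. beta_mult m p q \<in> filter_hull G)" for G
  obtain G where G: "G \<le> F" "G \<noteq> bot" "P G" "\<And>H. H \<le> G \<Longrightarrow> H \<noteq> bot \<Longrightarrow> P H \<Longrightarrow> H = G"
  proof (rule minimal_filter_exists[of F P])
    show "P F"
      using mult by (simp add: P_def)
    \<comment> \<open>The hull of an infimum is the intersection of the hulls, and intersections of
      subsemigroups are closed under multiplication.\<close>
    show "P (Inf C)" if "C \<noteq> {}" "\<forall>G\<in>C. P G" for C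
      using that by (fastforce simp: P_def filter_hull_iff le_Inf_iff)
  qed (use assms in auto)
  obtain p where p: "p \<in> filter_hull G"
    using ultrafilter_exists[OF G(2)] .
  have hull_delta: "q \<in> delta m" if "q \<in> filter_hull G" for q
    using that G(1) delta by (auto simp: filter_hull_iff)
  have mult': "beta_mult m q r \<in> filter_hull G" if "q \<in> filter_hull G" "r \<in> filter_hull G" for q r
    using G(3) that by (simp add: P_def)
  have assoc: "beta_mult m (beta_mult m q r) s = beta_mult m q (beta_mult m r s)"
    if "r \<in> filter_hull G" "s \<in> filter_hull G" for q r s
    using that by (intro beta_mult_assoc m hull_delta mult')
      (auto simp: filter_hull_iff is_ultrafilter_def)
  note pd = hull_delta[OF p]
  have pu: "is_ultrafilter p"
    using p by (simp add: filter_hull_iff)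

  \<comment> \<open>Together with \<open>mult_hull\<close> this identifies the hull of
    \<open>G \<cdot> p\<close> with the left ideal of all \<open>q \<cdot> p\<close>,
    \<open>q\<close> in the hull of \<open>G\<close>.\<close>
  have hull_mult: "\<exists>q\<in>filter_hull G. beta_mult m q p = r" if "r \<in> filter_hull (beta_mult m G p)" for r
  proof -
    have r: "is_ultrafilter r" "r \<le> beta_mult m G p"
      using that by (auto simp: filter_hull_iff)
    obtain q where q: "q \<in> filter_hull G" "beta_mult m q p \<le> r"
      using ultrafilter_below_beta_mult[OF pd pu r] .
    moreover have "is_ultrafilter (beta_mult m q p)"
      using mult'[OF q(1) p] by (simp add: filter_hull_iff)
    ultimately show ?thesis
      using ultrafilter_le_eq r(1) by blast
  qed
  have mult_hull: "beta_mult m q p \<in> filter_hull (beta_mult m G p)" if "q \<in> filter_hull G" for q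
    using that mult'[OF that p] by (simp add: filter_hull_iff beta_mult_mono[OF pd])
  have Gp: "beta_mult m G p = G"
  proof (rule G(4))
    show "beta_mult m G p \<noteq> bot"
      using G(2) pu by (simp add: trivial_limit_def eventually_beta_mult[OF pd] is_ultrafilter_def)
    show "P (beta_mult m G p)"
      unfolding P_def
    proof (intro ballI)
      fix r s assume "r \<in> filter_hull (beta_mult m G p)" "s \<in> filter_hull (beta_mult m G p)"
      then obtain r' s' where *: "r' \<in> filter_hull G" "s' \<in> filter_hull G"
        "r = beta_mult m r' p" "s = beta_mult m s' p"
        using hull_mult by metis
      \<comment> \<open>The product \<open>(r' \<cdot> p) \<cdot> (s' \<cdot> p)\<close> is
        rewritten with \<open>p\<close> as its last factor, so it lies in the left ideal
        again.\<close>
      then have "beta_mult m r s = beta_mult m (beta_mult m (beta_mult m r' p) s') p"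
        using assoc[OF *(2) p] by simp
      then show "beta_mult m r s \<in> filter_hull (beta_mult m G p)"
        using * p by (simp add: mult_hull mult')
    qed
    show "beta_mult m G p \<le> G"
    \<comment> \<open>The inclusion of hulls is turned into one of filters: a member
      \<open>Q\<close> of \<open>G\<close> missing from \<open>G \<cdot> p\<close> would be avoided
      by some ultrafilter below \<open>G \<cdot> p\<close>, which nevertheless lies in the hull of
      \<open>G\<close>.\<close>
    proof (rule ccontr)
      assume "\<not> beta_mult m G p \<le> G"
      then obtain Q where Q: "eventually Q G" "\<not> eventually Q (beta_mult m G p)"
        by (auto simp: le_filter_def)
      then have "inf (beta_mult m G p) (principal {x. \<not> Q x}) \<noteq> bot"
        by (simp add: trivial_limit_def eventually_inf_principal)
      then obtain r where "r \<in> filter_hull (inf (beta_mult m G p) (principal {x. \<not> Q x}))"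
        by (rule ultrafilter_exists)
      then have r: "r \<in> filter_hull (beta_mult m G p)" "eventually (\<lambda>x. \<not> Q x) r"
        by (auto simp: filter_hull_iff le_principal)
      with hull_mult mult' p have "r \<in> filter_hull G"
        by blast
      with Q(1) r(2) show False
        by (auto simp: filter_hull_iff le_filter_def ultrafilter_eventually_not)
    qed
  qed

  \<comment> \<open>Adding these preimages of the members of \<open>p\<close> to \<open>G\<close>
    expresses \<open>q \<cdot> p = p\<close> as a condition on the filter below which
    \<open>q\<close> lies, so the stabilizer of \<open>p\<close> is a hull.\<close>
  define H where "H = inf G (INF P\<in>{P. eventually P p}.
    principal {x. \<forall>\<^sub>F y in p. \<exists>z. m x y = Some z \<and> P z})"
  have H: "q \<in> filter_hull H \<longleftrightarrow> q \<in> filter_hull G \<and> beta_mult m q p = p" for q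
  proof -
    have "q \<in> filter_hull H \<longleftrightarrow> q \<in> filter_hull G \<and> beta_mult m q p \<le> p"
      by (auto simp: filter_hull_iff H_def le_INF_iff le_principal le_filter_def[of _ p]
          eventually_beta_mult[OF pd])
    moreover have "is_ultrafilter (beta_mult m q p)" if "q \<in> filter_hull G"
      using mult'[OF that p] by (simp add: filter_hull_iff)
    ultimately show ?thesis
      using ultrafilter_le_eq pu by auto
  qed
  have "H = G"
  proof (rule G(4))
    show "H \<le> G"
      by (simp add: H_def)
    \<comment> \<open>The stabilizer is nonempty because \<open>p\<close> itself lies in the hull of
      \<open>G \<cdot> p = G\<close>.\<close>
    obtain q where "q \<in> filter_hull G" "beta_mult m q p = p"
      using hull_mult[of p] p by (auto simp: Gp)
    then have "q \<in> filter_hull H"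
      by (simp add: H)
    then show "H \<noteq> bot"
      by (auto simp: filter_hull_iff is_ultrafilter_def bot_unique)
    show "P H"
      using p by (auto simp: P_def H mult' assoc)
  qed
  then have "beta_mult m p p = p"
    using p H by blast
  moreover have "p \<in> filter_hull F"
    using p G(1) by (auto simp: filter_hull_iff)
  ultimately show ?thesis
    by blast
qed

section \<open>From joint recurrence to an idempotent\<close>

lemma limitin_beta_mult:
  assumes T: "dynamical_system m X T" and z: "z \<in> topspace X"
    and q: "q \<in> delta m"
    and lim: "limitin X (\<lambda>s. T s z) y q" "limitin X (\<lambda>s. T s y) y p"
  shows "limitin X (\<lambda>s. T s z) y (beta_mult m p q)"
  unfolding limitin_def
proof (intro conjI allI impI)
  show y: "y \<in> topspace X"
    using lim by (simp add: limitin_def)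
  fix V assume V: "openin X V \<and> y \<in> V"
  \<comment> \<open>An iterated limit: for fixed \<open>s\<close>, continuity makes
    \<open>T s (T t z)\<close> tend to \<open>T s y\<close> along \<open>q\<close>, and
    \<open>T s y\<close> tends to \<open>y\<close> along \<open>p\<close>. The starting point
    \<open>z\<close> will be \<open>x\<close> as well as \<open>y\<close>.\<close>
  have "\<forall>\<^sub>F s in p. T s y \<in> V"
    using lim(2) V by (simp add: limitin_def)
  then have "\<forall>\<^sub>F s in p. \<forall>\<^sub>F t in q. \<exists>u. m s t = Some u \<and> T u z \<in> V"
  proof (rule eventually_mono)
    fix s assume s: "T s y \<in> V"
    have "openin X {w \<in> topspace X. T s w \<in> V}"
      using T V unfolding dynamical_system_def by (blast intro: openin_continuous_map_preimage)
    then have "\<forall>\<^sub>F t in q. T t z \<in> {w \<in> topspace X. T s w \<in> V}"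
      using lim(1) s y unfolding limitin_def by blast
    with delta_eventually_defined[OF q, of s]
    show "\<forall>\<^sub>F t in q. \<exists>u. m s t = Some u \<and> T u z \<in> V"
    proof eventually_elim
      case (elim t)
      then obtain u where "m s t = Some u"
        by blast
      moreover from this have "T s (T t z) = T u z"
        using T z by (force simp: dynamical_system_def phi_def)
      ultimately show ?case
        using elim by auto
    qed
  qed
  then show "\<forall>\<^sub>F s in beta_mult m p q. T s z \<in> V"
    by (simp add: eventually_beta_mult[OF q])
qed

text \<open>Makes convergence a filter inequality, so that the ultrafilters along which an orbit
  converges to \<open>l\<close> form a hull.\<close>

lemma limitin_iff_le_filtercomap:
  assumes "l \<in> topspace X"
  shows "limitin X f l F \<longleftrightarrow> F \<le> filtercomap f (nhdsin X l)"
proof -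
  have "filterlim f (nhdsin X l) F \<longleftrightarrow> (\<forall>S. openin X S \<and> l \<in> S \<longrightarrow> (\<forall>\<^sub>F s in F. f s \<in> S))"
  proof (intro iffI allI impI)
    fix S assume lim: "filterlim f (nhdsin X l) F" and S: "openin X S \<and> l \<in> S"
    have "eventually (\<lambda>x. x \<in> S) (nhdsin X l)"
      unfolding eventually_nhdsin using S by blast
    with lim show "\<forall>\<^sub>F s in F. f s \<in> S"
      unfolding filterlim_iff by blast
  next
    assume S: "\<forall>S. openin X S \<and> l \<in> S \<longrightarrow> (\<forall>\<^sub>F s in F. f s \<in> S)"
    show "filterlim f (nhdsin X l) F"
      unfolding filterlim_iff
    proof (intro allI impI)
      fix P assume "eventually P (nhdsin X l)"
      then obtain S where "openin X S" "l \<in> S" "\<forall>x\<in>S. P x"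
        using assms by (auto simp: eventually_nhdsin)
      moreover from this S have "\<forall>\<^sub>F s in F. f s \<in> S"
        by blast
      ultimately show "\<forall>\<^sub>F s in F. P (f s)"
        by (auto elim: eventually_mono)
    qed
  qed
  then show ?thesis
    using assms by (simp add: limitin_def filterlim_iff_le_filtercomap)
qed

lemma eventually_filtercomap_nhdsin:
  assumes "l \<in> topspace X" "eventually P (filtercomap f (nhdsin X l))"
  obtains V where "openin X V" "l \<in> V" "\<And>s. f s \<in> V \<Longrightarrow> P s"
proof -
  obtain Q where Q: "eventually Q (nhdsin X l)" "\<And>s. Q (f s) \<Longrightarrow> P s"
    using assms(2) unfolding eventually_filtercomap by blast
  obtain V where "openin X V" "l \<in> V" "\<forall>x\<in>V. Q x"
    using Q(1) assms(1) unfolding eventually_nhdsin by blast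
  with Q(2) show thesis
    by (intro that) auto
qed

theorem dynamically_represented_imp_idempotent:
  fixes m :: "'a \<Rightarrow> 'a \<Rightarrow> 'a option" and K :: "'a filter"
  assumes m: "partial_semigroup m"
    and K: "compact_subsemigroup_delta m (filter_hull K)"
    and A: "dynamically_represented TYPE('x) m K A"
  shows "\<exists>p\<in>filter_hull K. beta_mult m p p = p \<and> A \<in> members p"
proof -
  obtain X :: "'x topology" and T x y U where T: "dynamical_system m X T"
    and x: "x \<in> topspace X" and y: "y \<in> topspace X" and U: "neighborhood X y U"
    and rec: "jointly_recurrent K X T x y" and A_eq: "A = {s. T s x \<in> U}"
    using A unfolding dynamically_represented_def by blast
  define F where "F = inf K (inf (filtercomap (\<lambda>s. T s x) (nhdsin X y))
    (filtercomap (\<lambda>s. T s y) (nhdsin X y)))"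
  have hull: "p \<in> filter_hull F \<longleftrightarrow> p \<in> filter_hull K \<and>
      limitin X (\<lambda>s. T s x) y p \<and> limitin X (\<lambda>s. T s y) y p" for p
    by (auto simp: filter_hull_iff F_def limitin_iff_le_filtercomap[OF y])
  have delta: "filter_hull K \<subseteq> delta m"
    and mult: "\<And>p q. p \<in> filter_hull K \<Longrightarrow> q \<in> filter_hull K \<Longrightarrow> beta_mult m p q \<in> filter_hull K"
    using K by (auto simp: compact_subsemigroup_delta_def)
  have "F \<noteq> bot"
  proof
    assume "F = bot"
    then obtain P Q R where PQR: "eventually P K"
      "eventually Q (filtercomap (\<lambda>s. T s x) (nhdsin X y))"
      "eventually R (filtercomap (\<lambda>s. T s y) (nhdsin X y))"
      "\<And>s. P s \<Longrightarrow> Q s \<Longrightarrow> R s \<Longrightarrow> False"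
      unfolding F_def trivial_limit_def eventually_inf by blast
    obtain V where V: "openin X V" "y \<in> V" "\<And>s. T s x \<in> V \<Longrightarrow> Q s"
      using eventually_filtercomap_nhdsin[OF y PQR(2)] by metis
    obtain W where W: "openin X W" "y \<in> W" "\<And>s. T s y \<in> W \<Longrightarrow> R s"
      using eventually_filtercomap_nhdsin[OF y PQR(3)] by metis
    \<comment> \<open>Properness of \<open>F\<close> is where joint recurrence enters: a single
      neighborhood \<open>V \<inter> W\<close> handles both orbits, and the set of common return
      times would have its complement in \<open>K\<close>.\<close>
    have "neighborhood X y (V \<inter> W)"
      using V(1,2) W(1,2) openin_subset[OF V(1)] unfolding neighborhood_def by blast
    then have "{s. T s x \<in> V \<inter> W \<and> T s y \<in> V \<inter> W} \<in> script_L K"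
      using rec unfolding jointly_recurrent_def by blast
    then have "\<not> (\<forall>\<^sub>F s in K. \<not> (T s x \<in> V \<inter> W \<and> T s y \<in> V \<inter> W))"
      unfolding script_L_def members_def by simp
    moreover have "\<forall>\<^sub>F s in K. \<not> (T s x \<in> V \<inter> W \<and> T s y \<in> V \<inter> W)"
      by (rule eventually_mono[OF PQR(1)]) (use PQR(4) V(3) W(3) in blast)
    ultimately show False
      by blast
  qed
  moreover have "filter_hull F \<subseteq> delta m"
    using delta by (auto simp: hull)
  moreover have "beta_mult m p q \<in> filter_hull F"
    if "p \<in> filter_hull F" "q \<in> filter_hull F" for p q
    using that delta x y by (auto simp: hull intro: mult limitin_beta_mult[OF T])
  ultimately obtain p where p: "p \<in> filter_hull F" "beta_mult m p p = p"
    using idempotent_in_filter_hull[OF m] by blast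
  obtain V where V: "openin X V" "y \<in> V" "V \<subseteq> U"
    using U by (auto simp: neighborhood_def)
  then have "\<forall>\<^sub>F s in p. T s x \<in> V"
    using p(1) by (auto simp: hull limitin_def)
  then have "A \<in> members p"
    using V(3) by (auto simp: members_def A_eq elim: eventually_mono)
  with p show ?thesis
    by (auto simp: hull)
qed

section \<open>The shift system of an idempotent\<close>

text \<open>\<open>None\<close> plays the role of an identity adjoined to the semigroup.\<close>

definition shift :: "('a \<Rightarrow> 'a \<Rightarrow> 'a option) \<Rightarrow> 'a \<Rightarrow> ('a option \<Rightarrow> bool) \<Rightarrow> 'a option \<Rightarrow> bool" where
  "shift m s f u = (case u of None \<Rightarrow> f (Some s) | Some v \<Rightarrow> \<exists>w. m v s = Some w \<and> f (Some w))"

abbreviation cantor_space :: "('i \<Rightarrow> bool) topology" where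
  "cantor_space \<equiv> product_topology (\<lambda>_. discrete_topology UNIV) UNIV"

lemma limitin_cantor_space:
  "limitin cantor_space f l F \<longleftrightarrow> (\<forall>i. \<forall>\<^sub>F s in F. f s i = l i)"
proof -
  have "limitin (discrete_topology UNIV) g b F \<longleftrightarrow> (\<forall>\<^sub>F s in F. g s = b)" for g :: "_ \<Rightarrow> bool" and b
  proof
    assume "limitin (discrete_topology UNIV) g b F"
    then have "\<forall>\<^sub>F s in F. g s \<in> {b}"
      unfolding limitin_def by (elim conjE allE[of _ "{b}"]) simp
    then show "\<forall>\<^sub>F s in F. g s = b"
      by simp
  next
    assume "\<forall>\<^sub>F s in F. g s = b"
    then show "limitin (discrete_topology UNIV) g b F"
      by (auto simp: limitin_def elim: eventually_mono)
  qed
  then show ?thesis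
    by (simp add: limitin_componentwise)
qed

lemma dynamical_system_shift:
  assumes m: "partial_semigroup m"
  shows "dynamical_system m cantor_space (shift m)"
  unfolding dynamical_system_def
proof (intro conjI allI impI ballI)
  show "compact_space (cantor_space :: ('a option \<Rightarrow> bool) topology)"
    by (simp add: compact_space_product_topology compact_space_discrete_topology)
  show "Hausdorff_space (cantor_space :: ('a option \<Rightarrow> bool) topology)"
    by (simp add: Hausdorff_space_product_topology)
  show "continuous_map cantor_space cantor_space (shift m s)" for s
    unfolding continuous_map_componentwise_UNIV
  proof
    fix u
    have proj: "continuous_map cantor_space (discrete_topology UNIV) (\<lambda>f. f i)" for i :: "'a option"
      by (rule continuous_map_product_projection) simp
    \<comment> \<open>For fixed \<open>s\<close>, each coordinate of \<open>shift m s f\<close> is a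
      coordinate of \<open>f\<close> or, where \<open>m v s\<close> is undefined, constantly
      \<open>False\<close>.\<close>
    show "continuous_map cantor_space (discrete_topology UNIV) (\<lambda>f. shift m s f u)"
    proof (cases u)
      case None
      then show ?thesis
        using proj by (simp add: shift_def)
    next
      case (Some v)
      then show ?thesis
        using proj by (cases "m v s") (simp_all add: shift_def)
    qed
  qed
  fix s t and f :: "'a option \<Rightarrow> bool"
  assume "t \<in> phi m s"
  then obtain st where st: "m s t = Some st"
    by (auto simp: phi_def)
  show "shift m s (shift m t f) = shift m (the (m s t)) f"
  proof
    fix u
    show "shift m s (shift m t f) u = shift m (the (m s t)) f u"
      using partial_semigroup_bind[OF m, of s t _ "\<lambda>w. f (Some w)"] st
      by (cases u) (auto simp: shift_def)
  qed
qed

theorem idempotent_imp_dynamically_represented: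
  fixes m :: "'a \<Rightarrow> 'a \<Rightarrow> 'a option"
  assumes m: "partial_semigroup m"
    and p: "p \<in> delta m" "p \<in> filter_hull K" "beta_mult m p p = p" "A \<in> members p"
  shows "dynamically_represented TYPE('a option \<Rightarrow> bool) m K A"
proof -
  define x where "x u = (case u of None \<Rightarrow> False | Some s \<Rightarrow> s \<in> A)" for u
  define y where "y u \<longleftrightarrow> (\<forall>\<^sub>F s in p. shift m s x u)" for u
  have pu: "is_ultrafilter p"
    using p(2) by (simp add: filter_hull_iff)
  \<comment> \<open>An ultrafilter decides every predicate, so the coordinatewise limit
    \<open>y\<close> exists.\<close>
  have const: "\<forall>\<^sub>F s in p. P s \<longleftrightarrow> c" if "c \<longleftrightarrow> eventually P p" for P c
    using that ultrafilter_eventually_not[OF pu, of P] by (cases c) auto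
  have limx: "limitin cantor_space (\<lambda>s. shift m s x) y p"
    unfolding limitin_cantor_space by (auto simp: y_def intro: const)
  have idem: "eventually P p \<longleftrightarrow> (\<forall>\<^sub>F s in p. \<forall>\<^sub>F t in p. \<exists>z. m s t = Some z \<and> P z)" for P
    using eventually_beta_mult[OF p(1), of P p] p(3) by simp
  \<comment> \<open>Idempotence replaces the limit of \<open>shift m s x\<close> by the iterated
    limit of \<open>shift m s (shift m t x)\<close>, whose inner limit is
    \<open>shift m s y\<close>; this is checked coordinate by coordinate.\<close>
  have "y u \<longleftrightarrow> (\<forall>\<^sub>F s in p. shift m s y u)" for u
  proof (cases u)
    case None
    then show ?thesis
      using idem[of "\<lambda>s. s \<in> A"] by (simp add: y_def shift_def x_def)
  next
    case (Some v)
    have bot: "p \<noteq> bot"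
      using pu by (simp add: is_ultrafilter_def)
    have "y u \<longleftrightarrow> (\<forall>\<^sub>F s in p. \<forall>\<^sub>F t in p. \<exists>z. m s t = Some z \<and> (\<exists>w. m v z = Some w \<and> w \<in> A))"
      using idem[of "\<lambda>s. \<exists>w. m v s = Some w \<and> w \<in> A"] Some by (simp add: y_def shift_def x_def)
    also have "\<dots> \<longleftrightarrow> (\<forall>\<^sub>F s in p. shift m s y u)"
    proof (rule arg_cong[of _ _ "\<lambda>P. eventually P p"], rule ext)
      fix s
      show "(\<forall>\<^sub>F t in p. \<exists>z. m s t = Some z \<and> (\<exists>w. m v z = Some w \<and> w \<in> A)) = shift m s y u"
        \<comment> \<open>If \<open>m v s\<close> is undefined, both sides are false, the left one
          because \<open>p\<close> is proper.\<close>
        using bot Some by (cases "m v s")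
          (auto simp: partial_semigroup_bind[OF m] shift_def y_def x_def trivial_limit_def)
    qed
    finally show ?thesis .
  qed
  then have limy: "limitin cantor_space (\<lambda>s. shift m s y) y p"
    unfolding limitin_cantor_space by (auto intro: const)
  \<comment> \<open>At the adjoined identity, \<open>shift m s x\<close> has the truth value of
    \<open>s \<in> A\<close>, so this clopen set recovers \<open>A\<close> exactly.\<close>
  define U where "U = {f :: 'a option \<Rightarrow> bool. f None}"
  have "openin cantor_space {f \<in> topspace cantor_space. f (None :: 'a option) \<in> {True}}"
    by (rule openin_continuous_map_preimage[OF continuous_map_product_projection]) auto
  then have "openin cantor_space U"
    by (simp add: U_def)
  moreover have "y \<in> U"
    using p(4) by (simp add: U_def y_def shift_def x_def members_def)
  ultimately have "neighborhood cantor_space y U"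
    by (auto simp: neighborhood_def)
  moreover have "jointly_recurrent K cantor_space (shift m) x y"
    unfolding jointly_recurrent_def
  proof (intro allI impI)
    fix W :: "('a option \<Rightarrow> bool) set"
    assume "neighborhood cantor_space y W"
    then obtain V where V: "openin cantor_space V" "y \<in> V" "V \<subseteq> W"
      by (auto simp: neighborhood_def)
    have "\<forall>\<^sub>F s in p. shift m s x \<in> V" "\<forall>\<^sub>F s in p. shift m s y \<in> V"
      using V(1,2) limx limy by (auto simp: limitin_def)
    then have "\<forall>\<^sub>F s in p. shift m s x \<in> W \<and> shift m s y \<in> W"
      by eventually_elim (use V(3) in auto)
    \<comment> \<open>The common return times form a member of \<open>p\<close>, so their complement
      is not in \<open>p\<close> and hence not in the smaller family of members of
      \<open>K\<close>.\<close>
    then have "\<not> (\<forall>\<^sub>F s in p. \<not> (shift m s x \<in> W \<and> shift m s y \<in> W))"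
      by (simp only: ultrafilter_eventually_not[OF pu] not_not)
    moreover have "p \<le> K"
      using p(2) by (simp add: filter_hull_iff)
    ultimately show "{s. shift m s x \<in> W \<and> shift m s y \<in> W} \<in> script_L K"
      by (auto simp: script_L_def members_def le_filter_def)
  qed
  moreover have "A = {s. shift m s x \<in> U}"
    by (simp add: U_def shift_def x_def)
  ultimately show ?thesis
    unfolding dynamically_represented_def using dynamical_system_shift[OF m]
    by (intro exI[of _ cantor_space] exI[of _ "shift m"] exI[of _ x] exI[of _ y] exI[of _ U]) simp
qed

theorem theorem4p4:
  fixes m :: "'a \<Rightarrow> 'a \<Rightarrow> 'a option" and K :: "'a filter" and A :: "'a set"
  assumes "adequate_partial_semigroup m"
    and "K \<noteq> bot"
    and "compact_subsemigroup_delta m (filter_hull K)"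
  shows "((\<exists>p\<in>filter_hull K. beta_mult m p p = p \<and> A \<in> members p) \<longleftrightarrow>
           dynamically_represented TYPE('a option \<Rightarrow> bool) m K A) \<and>
         (dynamically_represented TYPE('x) m K A \<longrightarrow>
           (\<exists>p\<in>filter_hull K. beta_mult m p p = p \<and> A \<in> members p))"
proof -
  have m: "partial_semigroup m"
    using assms(1) by (simp add: adequate_partial_semigroup_def)
  have "dynamically_represented TYPE('a option \<Rightarrow> bool) m K A"
    if "\<exists>p\<in>filter_hull K. beta_mult m p p = p \<and> A \<in> members p"
    using that assms(3) idempotent_imp_dynamically_represented[OF m]
    by (auto simp: compact_subsemigroup_delta_def)
  then show ?thesis
    by (intro conjI iffI impI dynamically_represented_imp_idempotent[OF m assms(3)])
qed

end
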